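(* Let $1\le m\le M-1$ be integers, let $A\in\mathbb{R}^{M\times M}_{\rm sym}$ be positive semidefinite, let $B\in\mathbb{R}^{M\times M}_{\rm sym}$, and let $P_\star$ be a global minimizer of $J(P)=\mathrm{Tr}(BP)-\frac12\mathrm{Tr}(APAP)$ over $\mathcal M=\mathrm{Gr}(m,\mathbb{R}^M)$. Set $G(P_\star):=B-AP_\star A$. Then there exist an orthonormal basis $(x_k)_{1\le k\le M}$ of $\mathbb{R}^M$ and real numbers $\lambda_1\le\lambda_2\le\cdots\le\lambda_M$ such that $$P_\star=\sum_{k=1}^m x_kx_k^T,\qquad G(P_\star)=\sum_{k=1}^M\lambda_k x_kx_k^T .$$ In addition, if $A$ is invertible, then $\lambda_m<\lambda_{m+1}$ and $P_\star=\mathbf 1_{(-\infty,\mu]}(G(P_\star))$ for any $\mu\in[\lambda_m,\lambda_{m+1})$.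
   Context: $\mathbb{R}^{M\times M}_{\rm sym}$ is the space of real symmetric $M\times M$ matrices. $\mathrm{Gr}(m,\mathbb{R}^M):=\{P\in\mathbb{R}^{M\times M}_{\rm sym} : P^2=P,\ \mathrm{Tr}(P)=m\}$ is the set of rank-$m$ orthogonal projectors. For $H$ real symmetric and $I\subset\mathbb{R}$, $\mathbf 1_I(H)$ is the spectral projector of $H$ on $I$, i.e. the orthogonal projector onto the sum of the eigenspaces of $H$ associated with eigenvalues in $I$. *)

theory Defs
  imports "HOL-Analysis.Analysis"
begin

definition symmetric_matrix :: "real^'n^'n \<Rightarrow> bool" where
  "symmetric_matrix A \<longleftrightarrow> transpose A = A"

definition psd_matrix :: "real^'n^'n \<Rightarrow> bool" where
  "psd_matrix A \<longleftrightarrow> symmetric_matrix A \<and> (\<forall>x. 0 \<le> x \<bullet> (A *v x))"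

definition Gr :: "nat \<Rightarrow> (real^'n^'n) set" where
  "Gr m = {P. symmetric_matrix P \<and> P ** P = P \<and> trace P = real m}"

definition J :: "real^'n^'n \<Rightarrow> real^'n^'n \<Rightarrow> real^'n^'n \<Rightarrow> real" where
  "J A B P = trace (B ** P) - 1 / 2 * trace (A ** P ** A ** P)"

definition G :: "real^'n^'n \<Rightarrow> real^'n^'n \<Rightarrow> real^'n^'n \<Rightarrow> real^'n^'n" where
  "G A B P = B - A ** P ** A"

(* The product of a column and a row, x x^T; the type 1 has exactly one index. *)
definition outer :: "real^'n \<Rightarrow> real^'n^'n" where
  "outer x = (columnvector x :: real^1^'n) ** (rowvector x :: real^'n^1)"

lemma outer_nth [simp]: "outer x $ i $ j = x $ i * x $ j"
  by (simp add: outer_def columnvector_def rowvector_def matrix_matrix_mult_def)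

(* Bases are indexed by the numbers 1, ..., CARD('n); values at other indices are irrelevant. *)
definition orthonormal_basis :: "(nat \<Rightarrow> real^'n) \<Rightarrow> bool" where
  "orthonormal_basis x \<longleftrightarrow>
     (\<forall>i\<in>{1..CARD('n)}. \<forall>j\<in>{1..CARD('n)}. x i \<bullet> x j = (if i = j then 1 else 0)) \<and>
     span (x ` {1..CARD('n)}) = UNIV"

definition is_orthogonal_projector_onto :: "(real^'n) set \<Rightarrow> real^'n^'n \<Rightarrow> bool" where
  "is_orthogonal_projector_onto S P \<longleftrightarrow>
     symmetric_matrix P \<and> P ** P = P \<and> range ((*v) P) = S"

lemma symmetric_matrix_inner:
  assumes "symmetric_matrix P"
  shows "x \<bullet> (P *v y) = (P *v x) \<bullet> y"
  using assms unfolding symmetric_matrix_def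
  by (metis dot_lmul_matrix transpose_matrix_vector)

lemma is_orthogonal_projector_onto_unique:
  assumes P: "is_orthogonal_projector_onto S P" and Q: "is_orthogonal_projector_onto S Q"
  shows "P = Q"
proof -
  have fixed: "R *v y = y" if "is_orthogonal_projector_onto S R" "y \<in> S" for R y
    using that unfolding is_orthogonal_projector_onto_def
    by (metis imageE matrix_vector_mul_assoc)
  have mem: "R *v y \<in> S" if "is_orthogonal_projector_onto S R" for R y
    using that unfolding is_orthogonal_projector_onto_def by blast
  have sym: "symmetric_matrix P" "symmetric_matrix Q"
    using P Q unfolding is_orthogonal_projector_onto_def by auto
  have "P *v y = Q *v y" for y
  proof (rule vector_eq_rdot[THEN iffD1], intro allI)
    fix z
    have "(P *v y) \<bullet> z = (Q *v (P *v y)) \<bullet> z"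
      using fixed[OF Q mem[OF P]] by simp
    also have "\<dots> = y \<bullet> (P *v (Q *v z))"
      using symmetric_matrix_inner[OF sym(1)] symmetric_matrix_inner[OF sym(2)] by simp
    also have "\<dots> = (Q *v y) \<bullet> z"
      using fixed[OF P mem[OF Q]] symmetric_matrix_inner[OF sym(2)] by simp
    finally show "(P *v y) \<bullet> z = (Q *v y) \<bullet> z" .
  qed
  then show ?thesis by (simp add: matrix_eq)
qed

lemma is_orthogonal_projector_onto_exists:
  assumes S: "subspace (S :: (real^'n) set)"
  shows "\<exists>P. is_orthogonal_projector_onto S P"
proof -
  have sS: "span S = S" using S by (simp add: span_eq_iff)
  have "\<exists>y. y \<in> S \<and> (\<forall>w\<in>S. (x - y) \<bullet> w = 0)" for x
  proof -
    obtain y z where "y \<in> span S" "\<And>w. w \<in> span S \<Longrightarrow> orthogonal z w" "x = y + z"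
      using orthogonal_subspace_decomp_exists[of S x] by blast
    then show ?thesis using sS by (intro exI[of _ y]) (auto simp: orthogonal_def)
  qed
  then obtain f where fS: "\<And>x. f x \<in> S" and fo: "\<And>x w. w \<in> S \<Longrightarrow> (x - f x) \<bullet> w = 0"
    by metis
  have uniq: "f x = y" if "y \<in> S" "\<And>w. w \<in> S \<Longrightarrow> (x - y) \<bullet> w = 0" for x y
  proof -
    have "f x - y \<in> S" using S fS that(1) by (simp add: subspace_diff)
    then have "(f x - y) \<bullet> (f x - y) = (x - y) \<bullet> (f x - y) - (x - f x) \<bullet> (f x - y)"
      by (simp add: inner_diff_left)
    also have "\<dots> = 0" using that(2) fo \<open>f x - y \<in> S\<close> by simp
    finally show ?thesis by simp
  qed
  have lin: "linear f"
  proof (rule linearI)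
    show "f (a + b) = f a + f b" for a b
    proof (rule uniq)
      show "f a + f b \<in> S" using S fS by (simp add: subspace_add)
      show "(a + b - (f a + f b)) \<bullet> w = 0" if "w \<in> S" for w
        using fo[OF that, of a] fo[OF that, of b] by (simp add: inner_diff_left inner_add_left)
    qed
    show "f (r *\<^sub>R b) = r *\<^sub>R f b" for r b
    proof (rule uniq)
      show "r *\<^sub>R f b \<in> S" using S fS by (simp add: subspace_scale)
      show "(r *\<^sub>R b - r *\<^sub>R f b) \<bullet> w = 0" if "w \<in> S" for w
        using fo[OF that, of b] by (simp add: inner_diff_left)
    qed
  qed
  have app: "matrix f *v x = f x" for x
    using lin by (simp add: matrix_works)
  have id: "f y = y" if "y \<in> S" for y using uniq that by simp
  have sa: "x \<bullet> f y = f x \<bullet> y" for x y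
    using fo[OF fS, of x y] fo[OF fS, of y x] by (simp add: inner_diff_left) (metis inner_commute)
  have "transpose (matrix f) *v y = matrix f *v y" for y
  proof (rule vector_eq_ldot[THEN iffD1], intro allI)
    fix z
    have "z \<bullet> (transpose (matrix f) *v y) = (matrix f *v z) \<bullet> y"
      by (metis dot_lmul_matrix transpose_matrix_vector transpose_transpose)
    also have "\<dots> = z \<bullet> (matrix f *v y)" by (simp add: app sa)
    finally show "z \<bullet> (transpose (matrix f) *v y) = z \<bullet> (matrix f *v y)" .
  qed
  then have "symmetric_matrix (matrix f)"
    by (simp add: symmetric_matrix_def matrix_eq)
  moreover have "matrix f ** matrix f = matrix f"
    by (simp add: matrix_eq app id fS flip: matrix_vector_mul_assoc)
  moreover have "range ((*v) (matrix f)) = S"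
    using fS id by (auto simp: app) (metis rangeI)
  ultimately show ?thesis unfolding is_orthogonal_projector_onto_def by blast
qed

definition orthogonal_projector :: "(real^'n) set \<Rightarrow> real^'n^'n" where
  "orthogonal_projector S = (THE P. is_orthogonal_projector_onto S P)"

lemma is_orthogonal_projector_onto_orthogonal_projector:
  "subspace S \<Longrightarrow> is_orthogonal_projector_onto S (orthogonal_projector S)"
  unfolding orthogonal_projector_def
  by (rule theI') (metis is_orthogonal_projector_onto_exists is_orthogonal_projector_onto_unique)

definition eigenspace :: "real^'n^'n \<Rightarrow> real \<Rightarrow> (real^'n) set" where
  "eigenspace H t = {v. H *v v = t *\<^sub>R v}"

(* The eigenspace is {0} when t is not an eigenvalue, so t may range over all of I;
   the span of the union is the sum of the subspaces. *)
definition spectral_projector :: "real set \<Rightarrow> real^'n^'n \<Rightarrow> real^'n^'n" where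
  "spectral_projector I H = orthogonal_projector (span (\<Union>t\<in>I. eigenspace H t))"

end

theory Submission
  imports Defs
begin

text \<open>
  For \<open>D = P' - P\<close> one has \<open>J P' - J P = Tr (G D) - Tr (A D A D) / 2\<close>. It suffices to take
  the exchanges \<open>D = w w\<^sup>T - u u\<^sup>T\<close> with unit vectors \<open>u\<close> in the range of \<open>P\<close> and
  \<open>w\<close> in \<open>span {u} + ker P\<close>. For these, \<open>Tr (A D A D) = p\<^sup>2 + q\<^sup>2 - 2 r\<^sup>2\<close> with
  \<open>p = u \<bullet> A u\<close>, \<open>q = w \<bullet> A w\<close>, \<open>r = u \<bullet> A w\<close>, and \<open>2 \<bar>r\<bar> \<le> p + q\<close> makes this nonnegative,
  so minimality gives \<open>u \<bullet> G u \<le> w \<bullet> G w\<close>. Hence \<open>u\<close> is a stationary point of the Rayleigh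
  quotient of \<open>G\<close> on \<open>span {u} + ker P\<close>, which makes the range and the kernel of \<open>P\<close>
  invariant under \<open>G\<close>, and the eigenvalues on the range lie below those on the kernel.
  If \<open>A\<close> is invertible, hence positive definite, the inequality \<open>2 \<bar>r\<bar> < p + q\<close> is strict for
  orthogonal \<open>u\<close> and \<open>w\<close>, and so is the comparison of eigenvalues.
\<close>

section \<open>Self-adjoint maps: stationarity and ordered eigenbases\<close>

lemma nonneg_quadratic_imp_linear_coeff_zero:
  fixes b c :: real
  assumes "\<And>t. 0 \<le> t * (2 * b) + t\<^sup>2 * c"
  shows "b = 0"
proof (rule ccontr)
  assume b: "b \<noteq> 0"
  \<comment> \<open>With \<open>k\<close> positive and at least \<open>c\<close>, the quadratic at
    \<open>t = - b / k\<close> is at most \<open>- 2 b^2 / k + b^2 / k\<close>, which is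
    negative.\<close>
  define k where "k = \<bar>c\<bar> + 1"
  have k: "k > 0" "c \<le> k" by (auto simp: k_def)
  have "0 \<le> (- b / k) * (2 * b) + (- b / k)\<^sup>2 * c" by (rule assms)
  also have "\<dots> \<le> (- b / k) * (2 * b) + (- b / k)\<^sup>2 * k"
    using k by (intro add_left_mono mult_left_mono) auto
  also have "\<dots> = - (b\<^sup>2 / k)" using k by (simp add: field_simps power2_eq_square)
  also have "\<dots> < 0" using b k by simp
  finally show False by simp
qed

text \<open>First variation: at \<open>e + t y\<close> the difference of the two sides of
  \<open>min\<close> is a nonnegative quadratic in \<open>t\<close> without constant term, so its
  linear coefficient vanishes. Only test vectors from \<open>S\<close> enter, so \<open>f\<close>
  may map \<open>e\<close> out of \<open>S\<close>; this is the case when \<open>S\<close> is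
  \<open>span {e}\<close> plus the kernel of \<open>P\<close>.\<close>

lemma rayleigh_minimizer_stationary:
  fixes f :: "'a::real_inner \<Rightarrow> 'a"
  assumes f: "linear f" and sa: "\<And>x y. x \<bullet> f y = f x \<bullet> y"
    and S: "subspace S" and e: "e \<in> S" "e \<bullet> f e = l * (e \<bullet> e)"
    and min: "\<And>y. y \<in> S \<Longrightarrow> l * (y \<bullet> y) \<le> y \<bullet> f y"
    and y: "y \<in> S"
  shows "y \<bullet> f e = l * (y \<bullet> e)"
proof -
  have "0 \<le> t * (2 * (y \<bullet> f e - l * (y \<bullet> e))) + t\<^sup>2 * (y \<bullet> f y - l * (y \<bullet> y))" for t
  proof -
    have "e \<bullet> f y = y \<bullet> f e" using sa[of e y] by (simp add: inner_commute)
    moreover have "l * ((e + t *\<^sub>R y) \<bullet> (e + t *\<^sub>R y)) \<le> (e + t *\<^sub>R y) \<bullet> f (e + t *\<^sub>R y)"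
      by (intro min subspace_add subspace_scale S e y)
    ultimately show ?thesis using e(2)
      by (simp add: linear_add[OF f] linear_scale[OF f] inner_add_left inner_add_right
          inner_commute[of e y] algebra_simps power2_eq_square)
  qed
  then have "y \<bullet> f e - l * (y \<bullet> e) = 0"
    by (rule nonneg_quadratic_imp_linear_coeff_zero)
  then show ?thesis by simp
qed

text \<open>The Rayleigh quotient attains its minimum on the compact unit sphere of
  \<open>S\<close>. Invariance puts the residual \<open>f e - l *\<^sub>R e\<close> into
  \<open>S\<close>, where stationarity makes it orthogonal to itself.\<close>

lemma selfadjoint_min_eigenvector:
  fixes f :: "'a::euclidean_space \<Rightarrow> 'a"
  assumes f: "linear f" and sa: "\<And>x y. x \<bullet> f y = f x \<bullet> y"
    and S: "subspace S" "S \<noteq> {0}" and inv: "\<And>y. y \<in> S \<Longrightarrow> f y \<in> S"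
  obtains e l where "e \<in> S" "e \<bullet> e = 1" "f e = l *\<^sub>R e"
    "\<And>y. y \<in> S \<Longrightarrow> l * (y \<bullet> y) \<le> y \<bullet> f y"
proof -
  have "compact (sphere 0 1 \<inter> S)"
    by (simp add: compact_Int_closed closed_subspace S(1))
  moreover have unit: "y /\<^sub>R norm y \<in> sphere 0 1 \<inter> S" if "y \<in> S" "y \<noteq> 0" for y
    using that S(1) by (simp add: subspace_scale)
  moreover have "sphere 0 1 \<inter> S \<noteq> {}"
    using S unit subspace_0 by blast
  moreover have "continuous_on (sphere 0 1 \<inter> S) (\<lambda>y. y \<bullet> f y)"
    by (intro continuous_intros linear_continuous_on linear_conv_bounded_linear[THEN iffD1] f)
  ultimately obtain e where e: "e \<in> sphere 0 1 \<inter> S"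
    and le: "\<And>y. y \<in> sphere 0 1 \<inter> S \<Longrightarrow> e \<bullet> f e \<le> y \<bullet> f y"
    using continuous_attains_inf[of "sphere 0 1 \<inter> S" "\<lambda>y. y \<bullet> f y"] by blast
  define l where "l = e \<bullet> f e"
  have ee: "e \<in> S" "e \<bullet> e = 1" using e by (auto simp: norm_eq_1)
  have min: "l * (y \<bullet> y) \<le> y \<bullet> f y" if "y \<in> S" for y
  proof (cases "y = 0")
    case False
    then show ?thesis using le[OF unit[OF that False]]
      by (simp add: l_def linear_scale[OF f] field_simps flip: power2_eq_square power2_norm_eq_inner)
  qed (simp add: linear_0[OF f])
  have d: "f e - l *\<^sub>R e \<in> S" using ee inv S(1) by (simp add: subspace_diff subspace_scale)
  have "(f e - l *\<^sub>R e) \<bullet> f e = l * ((f e - l *\<^sub>R e) \<bullet> e)"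
    by (rule rayleigh_minimizer_stationary[OF f sa S(1) ee(1) _ min d]) (simp_all add: l_def ee)
  then have "(f e - l *\<^sub>R e) \<bullet> (f e - l *\<^sub>R e) = 0"
    by (simp add: inner_diff_right)
  then have "f e = l *\<^sub>R e" by simp
  with that ee min show ?thesis by blast
qed

text \<open>Spanning is encoded by the expansion formula, the form in which matrices are later
  compared with sums of \<open>outer\<close>. For a subspace \<open>S\<close> the clauses force
  \<open>d\<close> to be its dimension.\<close>

definition ordered_eigenbasis ::
  "('a::real_inner \<Rightarrow> 'a) \<Rightarrow> 'a set \<Rightarrow> nat \<Rightarrow> (nat \<Rightarrow> 'a) \<Rightarrow> (nat \<Rightarrow> real) \<Rightarrow> bool" where
  "ordered_eigenbasis f S d x lam \<longleftrightarrow>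
     (\<forall>i\<in>{1..d}. x i \<in> S \<and> f (x i) = lam i *\<^sub>R x i) \<and>
     (\<forall>i\<in>{1..d}. \<forall>j\<in>{1..d}. x i \<bullet> x j = (if i = j then 1 else 0)) \<and>
     mono_on {1..d} lam \<and>
     (\<forall>y\<in>S. (\<Sum>k=1..d. (x k \<bullet> y) *\<^sub>R x k) = y)"

text \<open>Concatenation along an orthogonal sum, the second list being shifted by
  \<open>d\<close>. It serves twice: to put a least eigenvector in front of a basis of its
  complement, and to join the range of \<open>P\<close> to its kernel.\<close>

lemma ordered_eigenbasis_append:
  assumes x: "ordered_eigenbasis f S d x lam" and y: "ordered_eigenbasis f T d' y mu"
    and orth: "\<And>s t. s \<in> S \<Longrightarrow> t \<in> T \<Longrightarrow> s \<bullet> t = 0"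
    and le: "\<And>i j. i \<in> {1..d} \<Longrightarrow> j \<in> {1..d'} \<Longrightarrow> lam i \<le> mu j"
    and sub: "S \<subseteq> R" "T \<subseteq> R"
    and decomp: "\<And>r. r \<in> R \<Longrightarrow> \<exists>s\<in>S. \<exists>t\<in>T. r = s + t"
  shows "ordered_eigenbasis f R (d + d')
    (\<lambda>k. if k \<le> d then x k else y (k - d)) (\<lambda>k. if k \<le> d then lam k else mu (k - d))"
    (is "ordered_eigenbasis f R _ ?z ?nu")
proof -
  have right: "k - d \<in> {1..d'}" if "k \<in> {1..d + d'}" "\<not> k \<le> d" for k
    using that by auto
  have ev: "?z i \<in> R \<and> f (?z i) = ?nu i *\<^sub>R ?z i" if "i \<in> {1..d + d'}" for i
    using that right[OF that] x y sub unfolding ordered_eigenbasis_def by (cases "i \<le> d") auto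
  have on: "?z i \<bullet> ?z j = (if i = j then 1 else 0)"
    if i: "i \<in> {1..d + d'}" and j: "j \<in> {1..d + d'}" for i j
  proof -
    have a: "x i \<bullet> y (j - d) = 0"
      if "i \<le> d" "\<not> j \<le> d" "i \<in> {1..d + d'}" "j \<in> {1..d + d'}" for i j
      using that right[of j] x y orth unfolding ordered_eigenbasis_def by auto
    show ?thesis
      using i j right[OF i] right[OF j] x y a[OF _ _ i j] a[OF _ _ j i]
      unfolding ordered_eigenbasis_def
      by (cases "i \<le> d"; cases "j \<le> d") (auto simp: inner_commute)
  qed
  have mono: "mono_on {1..d + d'} ?nu"
  proof (rule mono_onI)
    fix i j assume i: "i \<in> {1..d + d'}" and j: "j \<in> {1..d + d'}" and "i \<le> j"
    then show "?nu i \<le> ?nu j"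
      using right[OF i] right[OF j] x y le[of i "j - d"] unfolding ordered_eigenbasis_def
      by (cases "i \<le> d"; cases "j \<le> d") (auto simp: mono_on_def)
  qed
  have exp: "(\<Sum>k=1..d + d'. (?z k \<bullet> r) *\<^sub>R ?z k) = r" if r: "r \<in> R" for r
  proof -
    obtain s t where st: "s \<in> S" "t \<in> T" "r = s + t" using decomp[OF r] by blast
    have "(\<Sum>k=1..d + d'. (?z k \<bullet> r) *\<^sub>R ?z k)
        = (\<Sum>k=1..d. (?z k \<bullet> r) *\<^sub>R ?z k) + (\<Sum>k=d+1..d + d'. (?z k \<bullet> r) *\<^sub>R ?z k)"
      by (rule sum.ub_add_nat) simp
    also have "(\<Sum>k=1..d. (?z k \<bullet> r) *\<^sub>R ?z k) = (\<Sum>k=1..d. (x k \<bullet> s) *\<^sub>R x k)"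
      using x st orth unfolding ordered_eigenbasis_def
      by (intro sum.cong) (auto simp: inner_add_right)
    also have "(\<Sum>k=d+1..d + d'. (?z k \<bullet> r) *\<^sub>R ?z k) = (\<Sum>k=1..d'. (y k \<bullet> r) *\<^sub>R y k)"
      by (rule sum.reindex_bij_witness[of _ "\<lambda>k. k + d" "\<lambda>k. k - d"]) auto
    also have "\<dots> = (\<Sum>k=1..d'. (y k \<bullet> t) *\<^sub>R y k)"
      using y st orth unfolding ordered_eigenbasis_def
      by (intro sum.cong) (auto simp: inner_add_right inner_commute)
    finally show ?thesis using x y st unfolding ordered_eigenbasis_def by simp
  qed
  show ?thesis unfolding ordered_eigenbasis_def using ev on mono exp by blast
qed

text \<open>Induction on the dimension, splitting off an eigenvector of minimal Rayleigh quotient.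
  Its eigenvalue bounds all those on the orthogonal complement from below, so the list comes out
  sorted.\<close>

lemma ordered_eigenbasis_exists:
  fixes f :: "'a::euclidean_space \<Rightarrow> 'a"
  assumes f: "linear f" and sa: "\<And>x y. x \<bullet> f y = f x \<bullet> y"
  shows "subspace S \<Longrightarrow> (\<And>y. y \<in> S \<Longrightarrow> f y \<in> S) \<Longrightarrow> \<exists>d x lam. ordered_eigenbasis f S d x lam"
proof (induction "dim S" arbitrary: S rule: less_induct)
  case less
  show ?case
  proof (cases "S = {0}")
    case True
    then have "ordered_eigenbasis f S 0 (\<lambda>_. 0) (\<lambda>_. 0)"
      by (auto simp: ordered_eigenbasis_def mono_on_def)
    then show ?thesis by blast
  next
    case False
    obtain e l where e: "e \<in> S" "e \<bullet> e = 1" "f e = l *\<^sub>R e"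
      and min: "\<And>y. y \<in> S \<Longrightarrow> l * (y \<bullet> y) \<le> y \<bullet> f y"
      using selfadjoint_min_eigenvector[OF f sa less.prems(1) False less.prems(2)] by blast
    define T where "T = {y \<in> S. e \<bullet> y = 0}"
    have T: "subspace T"
      using less.prems(1) unfolding T_def subspace_def by (auto simp: inner_add_right)
    have "e \<notin> T" using e unfolding T_def by simp
    then have "T \<subset> S" using e unfolding T_def by blast
    then have "dim T < dim S"
      using T less.prems(1) by (metis dim_psubset span_eq_iff)
    \<comment> \<open>Self-adjointness moves \<open>f\<close> onto the eigenvector:
      \<open>e \<bullet> f y = l * (e \<bullet> y) = 0\<close>.\<close>
    moreover have "f y \<in> T" if "y \<in> T" for y
      using that less.prems(2) e sa[of e y] unfolding T_def by auto
    ultimately obtain d x lam where x: "ordered_eigenbasis f T d x lam"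
      using less.hyps[OF _ T] by blast
    have "(e \<bullet> y) *\<^sub>R e = y" if "y \<in> span {e}" for y
      using that e unfolding span_singleton by auto
    then have e_basis: "ordered_eigenbasis f (span {e}) 1 (\<lambda>_. e) (\<lambda>_. l)"
      using e by (simp add: ordered_eigenbasis_def mono_on_def span_base)
    have orth: "s \<bullet> t = 0" if "s \<in> span {e}" "t \<in> T" for s t
      using that unfolding T_def span_singleton by auto
    have le: "l \<le> lam j" if "j \<in> {1..d}" for j
    proof -
      have "x j \<in> S" "x j \<bullet> x j = 1" "f (x j) = lam j *\<^sub>R x j"
        using x that unfolding ordered_eigenbasis_def T_def by auto
      then show ?thesis using min[of "x j"] by simp
    qed
    have sub: "span {e} \<subseteq> S"
      using e less.prems(1) by (simp add: span_minimal)
    have decomp: "\<exists>s\<in>span {e}. \<exists>t\<in>T. r = s + t" if "r \<in> S" for r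
    proof (intro bexI)
      show "r = (e \<bullet> r) *\<^sub>R e + (r - (e \<bullet> r) *\<^sub>R e)" by simp
      show "r - (e \<bullet> r) *\<^sub>R e \<in> T"
        using that e less.prems(1) unfolding T_def
        by (simp add: subspace_diff subspace_scale inner_diff_right)
    qed (simp add: span_base span_scale)
    show ?thesis
      using ordered_eigenbasis_append[OF e_basis x orth le sub psubset_imp_subset[OF \<open>T \<subset> S\<close>] decomp]
      by blast
  qed
qed


section \<open>Matrix algebra: rank-one matrices, traces, distributivity\<close>

lemma outer_mult_vec [simp]: "outer x *v y = (x \<bullet> y) *\<^sub>R x"
  by (simp add: vec_eq_iff matrix_vector_mult_def inner_vec_def sum_distrib_left sum_distrib_right ac_simps)

lemma trace_mult_outer: "trace (M ** outer u) = u \<bullet> (M *v u)"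
  by (simp add: trace_def matrix_matrix_mult_def matrix_vector_mult_def inner_vec_def
      sum_distrib_left ac_simps)

lemma trace_outer: "trace (outer u) = u \<bullet> u"
  using trace_mult_outer[of "mat 1" u] by simp

lemma trace_sum: "trace (\<Sum>k\<in>K. F k) = (\<Sum>k\<in>K. trace (F k))"
  for F :: "'k \<Rightarrow> real^'n^'n"
  unfolding trace_def by (simp add: sum.swap[of _ K])

lemma sum_matrix_vector_mult: "(\<Sum>k\<in>K. F k) *v y = (\<Sum>k\<in>K. F k *v y)"
  for F :: "'k \<Rightarrow> real^'n^'m"
  by (induction K rule: infinite_finite_induct) (simp_all add: matrix_vector_mult_add_rdistrib)

lemma matrix_diff_ldistrib: "X ** (Y - Z) = X ** Y - X ** Z" for X :: "real^'n^'m"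
  by (simp add: matrix_eq matrix_vector_mult_diff_rdistrib matrix_vector_mult_diff_distrib
      flip: matrix_vector_mul_assoc)

lemma matrix_diff_rdistrib: "(X - Y) ** Z = X ** Z - Y ** Z" for X :: "real^'n^'m"
  by (simp add: matrix_eq matrix_vector_mult_diff_rdistrib flip: matrix_vector_mul_assoc)

lemma matrix_add_rdistrib: "(X + Y) ** Z = X ** Z + Y ** Z" for X :: "real^'n^'m"
  by (simp add: matrix_eq matrix_vector_mult_add_rdistrib flip: matrix_vector_mul_assoc)

section \<open>Expansion of \<open>J\<close> and rank-one exchanges in \<open>Gr m\<close>\<close>

text \<open>The exact second-order Taylor expansion, with \<open>G A B P\<close> as gradient. The
  two cross terms have equal trace by cyclicity, which cancels the factor 1/2.\<close>

lemma J_add: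
  "J A B (P + D) = J A B P + trace (G A B P ** D) - 1 / 2 * trace (A ** D ** A ** D)"
proof -
  have "trace (A ** D ** A ** P) = trace (A ** P ** A ** D)"
    using trace_mul_sym[of "A ** D" "A ** P"] by (simp add: matrix_mul_assoc)
  then show ?thesis
    by (simp add: J_def G_def matrix_add_ldistrib matrix_add_rdistrib matrix_diff_rdistrib
        trace_add trace_sub field_simps)
qed

lemma symmetric_matrix_G:
  fixes A B P :: "real^'a^'a"
  assumes "symmetric_matrix A" "symmetric_matrix B" "symmetric_matrix P"
  shows "symmetric_matrix (G A B P)"
proof -
  have "transpose (X - Y) = transpose X - transpose Y" for X Y :: "real^'a^'a"
    by (simp add: transpose_def vec_eq_iff)
  then show ?thesis
    using assms by (simp add: symmetric_matrix_def G_def matrix_transpose_mul matrix_mul_assoc)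
qed

text \<open>The condition on \<open>w\<close> says that \<open>w\<close> lies in
  \<open>span {u}\<close> plus the kernel of \<open>P\<close>. Such a \<open>w\<close> is orthogonal
  to the range of the projector \<open>P - outer u\<close>, so adding \<open>outer w\<close> gives a
  projector of the original rank.\<close>

lemma Gr_exchange:
  assumes P: "P \<in> Gr m" and u: "P *v u = u" "u \<bullet> u = 1" and w: "P *v w = (u \<bullet> w) *\<^sub>R u" "w \<bullet> w = 1"
  shows "P + (outer w - outer u) \<in> Gr m"
proof -
  let ?Q = "P + (outer w - outer u)"
  have P': "symmetric_matrix P" "P ** P = P" "trace P = m" using P by (auto simp: Gr_def)
  have "P $ i $ j = P $ j $ i" for i j
    using arg_cong[OF P'(1)[unfolded symmetric_matrix_def], of "\<lambda>X. X $ j $ i"]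
    by (simp add: transpose_def)
  then have "?Q $ i $ j = ?Q $ j $ i" for i j by (simp add: mult.commute)
  then have "symmetric_matrix ?Q"
    unfolding symmetric_matrix_def transpose_def vec_eq_iff vec_lambda_beta by blast
  moreover have "?Q *v (?Q *v y) = ?Q *v y" for y
  proof -
    have Qy: "?Q *v z = P *v z + (w \<bullet> z) *\<^sub>R w - (u \<bullet> z) *\<^sub>R u" for z
      by (simp add: matrix_vector_mult_add_rdistrib matrix_vector_mult_diff_rdistrib)
    have PP: "P *v (P *v y) = P *v y" using P'(2) by (simp add: matrix_vector_mul_assoc)
    \<comment> \<open>Applying \<open>?Q\<close> twice produces these two inner products besides
      those among \<open>u\<close>, \<open>w\<close> and \<open>y\<close>.\<close>
    have "u \<bullet> (P *v y) = u \<bullet> y" "w \<bullet> (P *v y) = (u \<bullet> w) * (u \<bullet> y)"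
      using symmetric_matrix_inner[OF P'(1)] u w by simp_all
    then show ?thesis
      using u w PP unfolding Qy
      by (simp add: matrix_vector_right_distrib matrix_vector_mult_diff_distrib
          matrix_vector_mult_scaleR inner_add_right inner_diff_right inner_commute[of w u]
          scaleR_add_left scaleR_diff_left)
  qed
  then have "?Q ** ?Q = ?Q" by (simp add: matrix_eq flip: matrix_vector_mul_assoc)
  moreover have "trace ?Q = m" using P' u w by (simp add: trace_add trace_sub trace_outer)
  ultimately show ?thesis by (simp add: Gr_def)
qed

section \<open>Inequalities for the quadratic form of \<open>A\<close>\<close>

text \<open>The two signs of the absolute value come from the form being nonnegative at
  \<open>u - w\<close> and at \<open>u + w\<close>.\<close>

lemma psd_matrix_inner_le:
  assumes "psd_matrix A"
  shows "2 * \<bar>u \<bullet> (A *v w)\<bar> \<le> u \<bullet> (A *v u) + w \<bullet> (A *v w)"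
proof -
  have "w \<bullet> (A *v u) = u \<bullet> (A *v w)"
    using assms symmetric_matrix_inner by (metis inner_commute psd_matrix_def)
  moreover have "0 \<le> (u + w) \<bullet> (A *v (u + w))" "0 \<le> (u - w) \<bullet> (A *v (u - w))"
    using assms by (auto simp: psd_matrix_def)
  ultimately show ?thesis
    by (simp add: matrix_vector_right_distrib matrix_vector_mult_diff_distrib inner_add_left
        inner_add_right inner_diff_left inner_diff_right)
qed

text \<open>A zero of a nonnegative form is a minimizer with \<open>l = 0\<close>. Stationarity,
  tested against \<open>A *v x\<close> itself, gives \<open>A *v x = 0\<close>, which invertibility
  excludes.\<close>

lemma psd_invertible_matrix_pos:
  assumes A: "psd_matrix A" "invertible A" and x: "x \<noteq> 0"
  shows "0 < x \<bullet> (A *v x)"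
proof (rule ccontr)
  assume "\<not> 0 < x \<bullet> (A *v x)"
  then have 0: "x \<bullet> (A *v x) = 0" using A(1) by (metis psd_matrix_def order_less_le)
  have "(A *v x) \<bullet> (A *v x) = 0 * ((A *v x) \<bullet> x)"
    by (rule rayleigh_minimizer_stationary[where S = UNIV])
      (use A(1) 0 symmetric_matrix_inner in \<open>auto simp: psd_matrix_def\<close>)
  then have "A *v x = 0" by simp
  with A(2) x show False
    by (metis invertible_def matrix_left_invertible_ker)
qed

lemma psd_invertible_matrix_inner_less:
  assumes A: "psd_matrix A" "invertible A" and "u \<noteq> w" "u \<noteq> - w"
  shows "2 * \<bar>u \<bullet> (A *v w)\<bar> < u \<bullet> (A *v u) + w \<bullet> (A *v w)"
proof -
  have "w \<bullet> (A *v u) = u \<bullet> (A *v w)"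
    using A symmetric_matrix_inner by (metis inner_commute psd_matrix_def)
  moreover have "u + w \<noteq> 0" "u - w \<noteq> 0" using assms(3,4) by (auto simp: eq_neg_iff_add_eq_0)
  then have "0 < (u + w) \<bullet> (A *v (u + w))" "0 < (u - w) \<bullet> (A *v (u - w))"
    using psd_invertible_matrix_pos[OF A] by blast+
  ultimately show ?thesis
    by (simp add: matrix_vector_right_distrib matrix_vector_mult_diff_distrib inner_add_left
        inner_add_right inner_diff_left inner_diff_right)
qed

section \<open>Consequences of minimality\<close>

text \<open>\<open>J_add\<close> for one exchange. The quadratic term is kept exactly: its
  nonnegativity yields the weak comparison of Rayleigh quotients, its strict positivity the spectral
  gap.\<close>

lemma minimizer_exchange:
  assumes A: "symmetric_matrix A" and P: "is_arg_min (J A B) (\<lambda>Q. Q \<in> Gr m) P"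
    and u: "P *v u = u" "u \<bullet> u = 1" and w: "P *v w = (u \<bullet> w) *\<^sub>R u" "w \<bullet> w = 1"
  shows "u \<bullet> (G A B P *v u) + 1 / 2 * ((u \<bullet> (A *v u))\<^sup>2 + (w \<bullet> (A *v w))\<^sup>2 - 2 * (u \<bullet> (A *v w))\<^sup>2)
    \<le> w \<bullet> (G A B P *v w)"
proof -
  let ?D = "outer w - outer u"
  have "P + ?D \<in> Gr m" using P u w by (intro Gr_exchange) (auto simp: is_arg_min_def)
  then have "J A B P \<le> J A B (P + ?D)" using P by (auto simp: is_arg_min_def not_less)
  then have "1 / 2 * trace (A ** ?D ** A ** ?D) \<le> trace (G A B P ** ?D)"
    by (simp add: J_add)
  also have "trace (G A B P ** ?D) = w \<bullet> (G A B P *v w) - u \<bullet> (G A B P *v u)"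
    by (simp add: matrix_diff_ldistrib trace_sub trace_mult_outer)
  finally have le: "1 / 2 * trace (A ** ?D ** A ** ?D) \<le> \<dots>" .
  have "w \<bullet> (A *v u) = u \<bullet> (A *v w)"
    using A symmetric_matrix_inner by (metis inner_commute)
  then have "trace (A ** ?D ** A ** ?D)
      = (u \<bullet> (A *v u))\<^sup>2 + (w \<bullet> (A *v w))\<^sup>2 - 2 * (u \<bullet> (A *v w))\<^sup>2"
    by (simp add: matrix_diff_ldistrib matrix_diff_rdistrib trace_sub trace_mult_outer
        matrix_vector_mult_scaleR power2_eq_square flip: matrix_vector_mul_assoc)
  with le show ?thesis by argo
qed

text \<open>Stated in homogeneous form, without normalizing \<open>w\<close>, to serve as the
  minimality hypothesis of \<open>rayleigh_minimizer_stationary\<close> on a whole subspace.\<close>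

lemma minimizer_rayleigh_le:
  assumes A: "psd_matrix A" and P: "is_arg_min (J A B) (\<lambda>Q. Q \<in> Gr m) P"
    and u: "P *v u = u" "u \<bullet> u = 1" and w: "P *v w = (u \<bullet> w) *\<^sub>R u"
  shows "u \<bullet> (G A B P *v u) * (w \<bullet> w) \<le> w \<bullet> (G A B P *v w)"
proof (cases "w = 0")
  case False
  define v where "v = w /\<^sub>R norm w"
  have "norm v = 1" using False by (simp add: v_def)
  then have v: "v \<bullet> v = 1" "P *v v = (u \<bullet> v) *\<^sub>R u"
    using w by (simp only: norm_eq_1) (simp add: v_def matrix_vector_mult_scaleR w)
  \<comment> \<open>In the notation \<open>p\<close>, \<open>q\<close>, \<open>r\<close>: \<open>4
    r^2 \<le> (p + q)^2 \<le> (p + q)^2 + (p - q)^2 = 2 p^2 + 2 q^2\<close>.\<close>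
  have "(2 * \<bar>u \<bullet> (A *v v)\<bar>)\<^sup>2 \<le> (u \<bullet> (A *v u) + v \<bullet> (A *v v))\<^sup>2"
    using psd_matrix_inner_le[OF A, of u v] by (intro power_mono) auto
  moreover have "0 \<le> (u \<bullet> (A *v u) - v \<bullet> (A *v v))\<^sup>2" by simp
  ultimately have "0 \<le> (u \<bullet> (A *v u))\<^sup>2 + (v \<bullet> (A *v v))\<^sup>2 - 2 * (u \<bullet> (A *v v))\<^sup>2"
    by (simp add: power2_sum power2_diff power_mult_distrib)
  then have le: "u \<bullet> (G A B P *v u) \<le> v \<bullet> (G A B P *v v)"
    using minimizer_exchange[OF _ P u v(2,1)] A unfolding psd_matrix_def by argo
  have "w = norm w *\<^sub>R v" using False by (simp add: v_def)
  then obtain c where "w = c *\<^sub>R v" by blast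
  with le v(1) show ?thesis
    by (simp add: matrix_vector_mult_scaleR mult_left_mono mult.assoc[symmetric] mult.commute)
qed simp

text \<open>The normalized \<open>u\<close> minimizes the Rayleigh quotient of
  \<open>G A B P\<close> on \<open>span {u}\<close> plus the kernel of \<open>P\<close>. That space
  contains \<open>v\<close>, which is orthogonal to \<open>u\<close>, so stationarity gives
  zero.\<close>

lemma minimizer_offdiagonal_zero:
  assumes A: "psd_matrix A" and B: "symmetric_matrix B"
    and P: "is_arg_min (J A B) (\<lambda>Q. Q \<in> Gr m) P"
    and u: "P *v u = u" and v: "P *v v = 0"
  shows "v \<bullet> (G A B P *v u) = 0"
proof (cases "u = 0")
  case False
  have symP: "symmetric_matrix P" using P by (auto simp: is_arg_min_def Gr_def)
  have symG: "symmetric_matrix (G A B P)"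
    using A B symP by (intro symmetric_matrix_G) (auto simp: psd_matrix_def)
  define e where "e = u /\<^sub>R norm u"
  have e: "P *v e = e" by (simp add: e_def matrix_vector_mult_scaleR u)
  have "norm e = 1" using False by (simp add: e_def)
  then have e1: "e \<bullet> e = 1" by (simp only: norm_eq_1)
  define S where "S = {w. P *v w = (e \<bullet> w) *\<^sub>R e}"
  have "e \<bullet> v = 0" using symmetric_matrix_inner[OF symP, of e v] e v by simp
  have "v \<bullet> (G A B P *v e) = (e \<bullet> (G A B P *v e)) * (v \<bullet> e)"
  proof (rule rayleigh_minimizer_stationary[where S = S])
    show "subspace S" unfolding S_def subspace_def
      by (simp add: matrix_vector_right_distrib matrix_vector_mult_scaleR inner_add_right scaleR_add_left)
    show "e \<in> S" "v \<in> S" using e e1 v \<open>e \<bullet> v = 0\<close> by (simp_all add: S_def)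
    show "(e \<bullet> (G A B P *v e)) * (y \<bullet> y) \<le> y \<bullet> (G A B P *v y)" if "y \<in> S" for y
      using minimizer_rayleigh_le[OF A P e e1] that by (simp add: S_def)
  qed (simp_all add: e1 symmetric_matrix_inner[OF symG])
  then have "v \<bullet> (G A B P *v e) = 0" using \<open>e \<bullet> v = 0\<close> by (simp add: inner_commute)
  then show ?thesis using False by (simp add: e_def matrix_vector_mult_scaleR)
qed simp

section \<open>Joint diagonalization of \<open>P\<close> and \<open>G A B P\<close>, and the
  spectral projector\<close>

lemma orthogonal_projector_eqI:
  "is_orthogonal_projector_onto S P \<Longrightarrow> orthogonal_projector S = P"
  unfolding orthogonal_projector_def
  by (rule the_equality, assumption, erule is_orthogonal_projector_onto_unique)

theorem theorem2:
  fixes A B P :: "real^'n^'n" and m :: nat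
  assumes "1 \<le> m" and "m \<le> CARD('n) - 1"
    and "psd_matrix A" and "symmetric_matrix B"
    and "is_arg_min (J A B) (\<lambda>Q. Q \<in> Gr m) P"
  shows "\<exists>(x :: nat \<Rightarrow> real^'n) (lam :: nat \<Rightarrow> real).
    orthonormal_basis x \<and> mono_on {1..CARD('n)} lam \<and>
    P = (\<Sum>k=1..m. outer (x k)) \<and>
    G A B P = (\<Sum>k=1..CARD('n). lam k *\<^sub>R outer (x k)) \<and>
    (invertible A \<longrightarrow>
       lam m < lam (m + 1) \<and>
       (\<forall>\<mu>. lam m \<le> \<mu> \<and> \<mu> < lam (m + 1) \<longrightarrow> P = spectral_projector {..\<mu>} (G A B P)))"
proof -
  have symA: "symmetric_matrix A" using assms(3) by (simp add: psd_matrix_def)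
  have P: "symmetric_matrix P" "P ** P = P" "trace P = m"
    using assms(5) by (auto simp: is_arg_min_def Gr_def)
  have PP: "P *v (P *v y) = P *v y" for y using P(2) by (simp add: matrix_vector_mul_assoc)
  have symG: "symmetric_matrix (G A B P)" by (rule symmetric_matrix_G[OF symA assms(4) P(1)])
  let ?f = "(*v) (G A B P)"
  note inP = symmetric_matrix_inner[OF P(1)] and inG = symmetric_matrix_inner[OF symG]
    and off = minimizer_offdiagonal_zero[OF assms(3-5)]
  define S where "S = {v. P *v v = v}"
  define T where "T = {v. P *v v = 0}"
  have S: "subspace S" and T: "subspace T"
    unfolding S_def T_def subspace_def
    by (simp_all add: matrix_vector_right_distrib matrix_vector_mult_scaleR)
  have invS: "?f u \<in> S" if "u \<in> S" for u
  proof -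
    \<comment> \<open>The kernel component of \<open>?f u\<close>: it is orthogonal to
      \<open>?f u\<close> by \<open>off\<close> and to \<open>P *v ?f u\<close> because
      \<open>P\<close> kills it, hence to itself.\<close>
    let ?z = "?f u - P *v ?f u"
    have z: "P *v ?z = 0" by (simp add: matrix_vector_mult_diff_distrib PP)
    have "?z \<bullet> ?f u = 0" using that off[OF _ z] by (simp add: S_def)
    moreover have "?z \<bullet> (P *v ?f u) = 0" using inP[of ?z "?f u"] z by simp
    ultimately have "?z \<bullet> ?z = 0" unfolding inner_diff_right by linarith
    then show ?thesis by (simp add: S_def)
  qed
  have invT: "?f v \<in> T" if "v \<in> T" for v
  proof -
    \<comment> \<open>Here \<open>off\<close> is applied to the range component of
      \<open>?f v\<close>; moving \<open>?f\<close> and then \<open>P\<close> across the inner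
      product turns this into its squared norm.\<close>
    have "v \<bullet> ?f (P *v ?f v) = 0" using that off[OF PP] by (simp add: T_def)
    then have "(P *v ?f v) \<bullet> ?f v = 0" using inG[of "P *v ?f v" v] by (simp add: inner_commute)
    then have "(P *v ?f v) \<bullet> (P *v ?f v) = 0" using inP[of "P *v ?f v" "?f v"] by (simp add: PP)
    then show ?thesis by (simp add: T_def)
  qed
  obtain d a la where a: "ordered_eigenbasis ?f S d a la"
    using ordered_eigenbasis_exists[OF _ inG S invS] by auto
  obtain d' b lb where b: "ordered_eigenbasis ?f T d' b lb"
    using ordered_eigenbasis_exists[OF _ inG T invT] by auto
  have orth: "s \<bullet> t = 0" if "s \<in> S" "t \<in> T" for s t
    using that inP[of s t] by (simp add: S_def T_def)
  have decomp: "\<exists>s\<in>S. \<exists>t\<in>T. r = s + t" for r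
    by (rule bexI[of _ "P *v r"], rule bexI[of _ "r - P *v r"])
      (simp_all add: S_def T_def matrix_vector_mult_diff_distrib PP)
  have exchange: "la i + 1 / 2 * ((a i \<bullet> (A *v a i))\<^sup>2 + (b j \<bullet> (A *v b j))\<^sup>2 - 2 * (a i \<bullet> (A *v b j))\<^sup>2) \<le> lb j"
    and le: "la i \<le> lb j" and ab_distinct: "a i \<noteq> b j" "a i \<noteq> - b j"
    if "i \<in> {1..d}" "j \<in> {1..d'}" for i j
  proof -
    have i: "a i \<in> S" "a i \<bullet> a i = 1" "?f (a i) = la i *\<^sub>R a i"
      and j: "b j \<in> T" "b j \<bullet> b j = 1" "?f (b j) = lb j *\<^sub>R b j"
      using a b that unfolding ordered_eigenbasis_def by auto
    have ab: "a i \<bullet> b j = 0" using i j orth by blast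
    then have "P *v b j = (a i \<bullet> b j) *\<^sub>R a i" using j by (simp add: T_def)
    moreover have "P *v a i = a i" using i by (simp add: S_def)
    ultimately show "la i + 1 / 2 * ((a i \<bullet> (A *v a i))\<^sup>2 + (b j \<bullet> (A *v b j))\<^sup>2 - 2 * (a i \<bullet> (A *v b j))\<^sup>2) \<le> lb j"
      and "la i \<le> lb j"
      using minimizer_exchange[OF symA assms(5), of "a i" "b j"]
        minimizer_rayleigh_le[OF assms(3,5), of "a i" "b j"] i j by simp_all
    show "a i \<noteq> b j" "a i \<noteq> - b j" using ab i j by auto
  qed
  have "P *v y = (\<Sum>k=1..d. outer (a k)) *v y" for y
  proof -
    have "P *v y = (\<Sum>k=1..d. (a k \<bullet> (P *v y)) *\<^sub>R a k)"
      using a PP unfolding ordered_eigenbasis_def S_def by simp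
    also have "\<dots> = (\<Sum>k=1..d. (a k \<bullet> y) *\<^sub>R a k)"
      using a inP unfolding ordered_eigenbasis_def S_def by (intro sum.cong) auto
    finally show ?thesis by (simp add: sum_matrix_vector_mult)
  qed
  then have Pa: "P = (\<Sum>k=1..d. outer (a k))" by (simp add: matrix_eq)
  \<comment> \<open>The trace counts the orthonormal vectors spanning the range, which identifies
    \<open>d\<close> with \<open>m\<close>; in the same way the trace of the identity gives the
    length of the joined basis below.\<close>
  have "trace P = d"
    using a unfolding Pa trace_sum trace_outer ordered_eigenbasis_def by simp
  then have d: "d = m" using P(3) by simp
  define x where "x = (\<lambda>k. if k \<le> m then a k else b (k - m))"
  define lam where "lam = (\<lambda>k. if k \<le> m then la k else lb (k - m))"
  have x: "ordered_eigenbasis ?f UNIV (m + d') x lam"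
    using ordered_eigenbasis_append[OF a b orth le subset_UNIV subset_UNIV decomp]
    unfolding x_def lam_def d .
  have "mat 1 *v y = (\<Sum>k=1..m + d'. outer (x k)) *v y" for y
    using x unfolding ordered_eigenbasis_def by (simp add: sum_matrix_vector_mult)
  then have I: "mat 1 = (\<Sum>k=1..m + d'. outer (x k))" by (simp only: matrix_eq) simp
  have "trace (mat 1 :: real^'n^'n) = m + d'"
    using x unfolding I trace_sum trace_outer ordered_eigenbasis_def by simp
  then have card: "CARD('n) = m + d'" by (simp add: trace_I)
  have x_ev: "?f (x i) = lam i *\<^sub>R x i" if "i \<in> {1..CARD('n)}" for i
    using x that unfolding ordered_eigenbasis_def card by blast
  have x_on: "x i \<bullet> x j = (if i = j then 1 else 0)" if "i \<in> {1..CARD('n)}" "j \<in> {1..CARD('n)}" for i j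
    using x that unfolding ordered_eigenbasis_def card by blast
  have x_mono: "mono_on {1..CARD('n)} lam"
    using x unfolding ordered_eigenbasis_def card by blast
  have x_exp: "(\<Sum>k=1..CARD('n). (x k \<bullet> y) *\<^sub>R x k) = y" for y
    using x unfolding ordered_eigenbasis_def card by blast
  have "y \<in> span (x ` {1..CARD('n)})" for y
    by (subst x_exp[symmetric]) (intro span_sum span_scale span_base imageI)
  then have basis: "orthonormal_basis x"
    using x_on unfolding orthonormal_basis_def by blast
  have Px: "P = (\<Sum>k=1..m. outer (x k))"
    unfolding Pa d by (intro sum.cong) (auto simp: x_def)
  have "?f y = (\<Sum>k=1..CARD('n). lam k *\<^sub>R outer (x k)) *v y" for y
  proof -
    have "?f y = (\<Sum>k=1..CARD('n). (x k \<bullet> ?f y) *\<^sub>R x k)" by (rule x_exp[symmetric])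
    also have "\<dots> = (\<Sum>k=1..CARD('n). (lam k *\<^sub>R outer (x k)) *v y)"
      by (intro sum.cong refl) (simp add: inG x_ev flip: scaleR_matrix_vector_assoc)
    finally show ?thesis by (simp add: sum_matrix_vector_mult)
  qed
  then have Gx: "G A B P = (\<Sum>k=1..CARD('n). lam k *\<^sub>R outer (x k))" by (simp add: matrix_eq)
  have gap: "lam m < lam (m + 1)" if "invertible A"
  proof -
    \<comment> \<open>The gap compares the last vector of the range with the first of the kernel;
      the bounds on \<open>m\<close> make both exist, and \<open>lam (m + 1)\<close> is
      \<open>lb 1\<close>.\<close>
    have ix: "m \<in> {1..d}" "1 \<in> {1..d'}" using assms(1,2) card d by auto
    let ?p = "a m \<bullet> (A *v a m)" and ?q = "b 1 \<bullet> (A *v b 1)" and ?r = "a m \<bullet> (A *v b 1)"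
    have "(2 * \<bar>?r\<bar>)\<^sup>2 < (?p + ?q)\<^sup>2"
      using psd_invertible_matrix_inner_less[OF assms(3) that ab_distinct[OF ix]]
      by (intro power_strict_mono) auto
    moreover have "0 \<le> (?p - ?q)\<^sup>2" by simp
    ultimately have "0 < ?p\<^sup>2 + ?q\<^sup>2 - 2 * ?r\<^sup>2"
      by (simp add: power2_sum power2_diff power_mult_distrib)
    then have "la m < lb 1" using exchange[OF ix] by argo
    then show ?thesis by (simp add: lam_def)
  qed
  have "P = spectral_projector {..\<mu>} (G A B P)" if \<mu>: "lam m \<le> \<mu>" "\<mu> < lam (m + 1)" for \<mu>
  proof -
    let ?E = "\<Union>t\<in>{..\<mu>}. eigenspace (G A B P) t"
    have Py: "P *v y = (\<Sum>k=1..m. (x k \<bullet> y) *\<^sub>R x k)" for y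
      unfolding Px by (simp add: sum_matrix_vector_mult)
    have "x k \<in> ?E" if "k \<in> {1..m}" for k
    proof -
      have "lam k \<le> lam m"
        using mono_onD[OF x_mono, of k m] that card by auto
      moreover have "k \<in> {1..CARD('n)}" using that card by auto
      ultimately show ?thesis using x_ev \<mu> by (auto simp: eigenspace_def intro: bexI[of _ "lam k"])
    qed
    then have "range ((*v) P) \<subseteq> span ?E"
      unfolding Py by (auto intro!: span_sum span_scale span_base[of "x _"])
    moreover have "v \<in> range ((*v) P)" if v: "v \<in> ?E" for v
    proof -
      obtain t where t: "t \<le> \<mu>" "?f v = t *\<^sub>R v" using v by (auto simp: eigenspace_def)
      \<comment> \<open>For \<open>k > m\<close> the eigenvalues satisfy
        \<open>t \<le> \<mu> < lam (m + 1) \<le> lam k\<close>, and eigenvectors for distinct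
        eigenvalues are orthogonal. So the expansion of \<open>v\<close> stops at \<open>m\<close>
        and \<open>P\<close> fixes \<open>v\<close>.\<close>
      have "x k \<bullet> v = 0" if k: "k \<in> {1..CARD('n)} - {1..m}" for k
      proof -
        have "lam (m + 1) \<le> lam k" using mono_onD[OF x_mono, of "m + 1" k] k by auto
        moreover have "lam k * (x k \<bullet> v) = t * (x k \<bullet> v)"
          using inG[of "x k" v] x_ev[of k] k t by auto
        ultimately show ?thesis using t \<mu> by auto
      qed
      then have "(\<Sum>k=1..m. (x k \<bullet> v) *\<^sub>R x k) = (\<Sum>k=1..CARD('n). (x k \<bullet> v) *\<^sub>R x k)"
        using card by (intro sum.mono_neutral_left) auto
      then have "P *v v = v" by (simp only: Py x_exp)
      then show ?thesis by (metis rangeI)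
    qed
    then have "span ?E \<subseteq> range ((*v) P)"
      by (intro span_minimal subsetI linear_subspace_image) auto
    ultimately have "is_orthogonal_projector_onto (span ?E) P"
      using P unfolding is_orthogonal_projector_onto_def by blast
    then show ?thesis
      unfolding spectral_projector_def by (rule orthogonal_projector_eqI[symmetric])
  qed
  with basis x_mono Px Gx gap show ?thesis by blast
qed

end
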